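(* Let $n\ge 1$ be an integer and let $a>1$ be a fixed real number. For any finite set of integers $S$, we have $$\chi_{\mathcal{A}_n^S}(t)=\chi_{\mathcal{C}_n^S}(t-1).$$
   Context: For a finite set $S$ of integers, $\mathcal{A}_n^S$ is the hyperplane arrangement in $\mathbb{R}^n$ given by $\{x_i=0\mid i\in[n]\}\cup\{x_i=a^kx_j\mid k\in S,\ 1\le i<j\le n\}$, and $\mathcal{C}_n^S$ is the arrangement in $\mathbb{R}^n$ given by $\{x_i-x_j=k\mid k\in S,\ 1\le i<j\le n\}$, where $[n]=\{1,\dots,n\}$. The intersection poset $\mathrm{L}(\mathcal{A})$ of an arrangement $\mathcal{A}$ in $\mathbb{R}^n$ is the set of flats (nonempty intersections of some of the hyperplanes, including the empty intersection $\mathbb{R}^n$), ordered by reverse inclusion, with minimum $\hat 0=\mathbb{R}^n$. The characteristic polynomial is $\chi_{\mathcal{A}}(t)=\sum_{x\in \mathrm{L}(\mathcal{A})}\mu(\hat 0,x)\,t^{\dim x}$, where $\mu$ is the Möbius function of $\mathrm{L}(\mathcal{A})$. *)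

theory Defs
  imports "HOL-Analysis.Analysis" "HOL-Computational_Algebra.Polynomial"
begin

text \<open>
  Moebius function of a finite poset, given as a reflexive order relation \<open>r\<close> on its field, where
  \<open>(x, y) \<in> r\<close> means \<open>x \<le> y\<close>. It is set to \<open>0\<close> where it is not defined, that is, for
  relations that are not finite partial orders and for pairs that are not comparable as \<open>x \<le> y\<close>.
\<close>

function mobius :: "('a \<times> 'a) set \<Rightarrow> 'a \<Rightarrow> 'a \<Rightarrow> int" where
  "mobius r x y =
     (if finite r \<and> Partial_order r \<and> (x, y) \<in> r
      then if x = y then 1
           else - (\<Sum>z | (x, z) \<in> r \<and> (z, y) \<in> r \<and> z \<noteq> y. mobius r x z)
      else 0)"
  by pat_completeness auto
termination
proof (relation "Wellfounded.measure (\<lambda>(r, x, y). card {z. (z, y) \<in> r})", goal_cases)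
  case 1
  show ?case by simp
next
  case (2 r x y z)
  then have fin: "finite r" and po: "Partial_order r" and zy: "(z, y) \<in> r" and ne: "z \<noteq> y"
    and xy: "(x, y) \<in> r"
    by auto
  have tr: "trans r" and an: "antisym r" and rf: "Refl r"
    using po by (auto simp: order_on_defs)
  have yy: "(y, y) \<in> r"
    using rf xy by (meson FieldI2 refl_onD)
  have "{w. (w, z) \<in> r} \<subseteq> {w. (w, y) \<in> r}"
    using tr zy by (auto dest: transD)
  moreover have "y \<notin> {w. (w, z) \<in> r}"
    using an zy ne by (auto dest: antisymD)
  ultimately have "{w. (w, z) \<in> r} \<subset> {w. (w, y) \<in> r}"
    using yy by blast
  moreover have "finite {w. (w, y) \<in> r}"
    by (rule finite_subset[of _ "fst ` r"]) (use fin in force)+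
  ultimately show ?case
    by (simp add: psubset_card_mono)
qed

declare mobius.simps [simp del]

text \<open>The empty intersection \<open>\<Inter>{}\<close> is the whole space, so it is always a flat.\<close>

definition flats :: "'a set set \<Rightarrow> 'a set set" where
  "flats \<A> = {\<Inter>\<B> |\<B>. \<B> \<subseteq> \<A> \<and> \<Inter>\<B> \<noteq> {}}"

definition intersection_poset :: "'a set set \<Rightarrow> ('a set \<times> 'a set) set" where
  "intersection_poset \<A> = {(x, y). x \<in> flats \<A> \<and> y \<in> flats \<A> \<and> x \<supseteq> y}"

text \<open>Flats of a hyperplane arrangement are nonempty affine subspaces, so \<open>aff_dim\<close> is nonnegative on them.\<close>

definition characteristic_poly :: "'a::euclidean_space set set \<Rightarrow> int poly" where
  "characteristic_poly \<A> =
     (\<Sum>x\<in>flats \<A>. monom (mobius (intersection_poset \<A>) UNIV x) (nat (aff_dim x)))"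

text \<open>
  Coordinates are indexed by an arbitrary finite linearly ordered type, which plays the role of
  \<open>{1, \<dots>, n}\<close> with \<open>n = CARD('n) \<ge> 1\<close>.
\<close>

definition arrangement_A :: "real \<Rightarrow> int set \<Rightarrow> (real ^ 'n::{finite,linorder}) set set" where
  "arrangement_A a S =
     {{x. x $ i = 0} |i. True} \<union>
     {{x. x $ i = a powi k * x $ j} |i j k. k \<in> S \<and> i < j}"

definition arrangement_C :: "int set \<Rightarrow> (real ^ 'n::{finite,linorder}) set set" where
  "arrangement_C S = {{x. x $ i - x $ j = of_int k} |i j k. k \<in> S \<and> i < j}"

lemma finite_flats: "finite \<A> \<Longrightarrow> finite (flats \<A>)"
  by (rule finite_subset[of _ "Inter ` Pow \<A>"]) (auto simp: flats_def)

lemma finite_intersection_poset: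
  assumes "finite \<A>"
  shows "finite (intersection_poset \<A>)"
  by (rule finite_subset[of _ "flats \<A> \<times> flats \<A>"])
    (auto simp: intersection_poset_def finite_flats assms)

lemma Field_intersection_poset: "Field (intersection_poset \<A>) = flats \<A>"
  by (auto simp: Field_def intersection_poset_def)

lemma Partial_order_intersection_poset: "Partial_order (intersection_poset \<A>)"
  unfolding order_on_defs Field_intersection_poset
  by (auto simp: intersection_poset_def refl_on_def trans_def antisym_def)

lemma finite_arrangement_A:
  assumes "finite S"
  shows "finite (arrangement_A a S :: (real ^ 'n::{finite,linorder}) set set)"
proof (rule finite_subset)
  show "arrangement_A a S \<subseteq> range (\<lambda>i. {x :: real ^ 'n::{finite,linorder}. x $ i = 0}) \<union>
          (\<lambda>(i, j, k). {x. x $ i = a powi k * x $ j}) ` (UNIV \<times> UNIV \<times> S)"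
    by (force simp: arrangement_A_def)
qed (use assms in auto)

lemma finite_arrangement_C:
  assumes "finite S"
  shows "finite (arrangement_C S :: (real ^ 'n::{finite,linorder}) set set)"
proof (rule finite_subset)
  show "arrangement_C S \<subseteq>
          (\<lambda>(i, j, k). {x :: real ^ 'n::{finite,linorder}. x $ i - x $ j = of_int k}) ` (UNIV \<times> UNIV \<times> S)"
    by (force simp: arrangement_C_def)
qed (use assms in auto)

end

theory Submission imports Defs begin

text \<open>
  Write \<open>E\<close> for the set of triples \<open>(i, j, k)\<close> with \<open>k \<in> S\<close> and \<open>i < j\<close>; each triple indexes one
  hyperplane \<open>x\<^sub>i = a\<^sup>k x\<^sub>j\<close> of the multiplicative arrangement and one hyperplane
  \<open>x\<^sub>i - x\<^sub>j = k\<close> of the additive one. Whitney's theorem (\<open>characteristic_poly_Whitney\<close>) turns both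
  characteristic polynomials into signed sums over sets of indices,
  \<open>\<Sum> (-1)\<^bsup>card\<^esup> t\<^bsup>dim\<^esup>\<close>, which makes it possible to compare them one
  \<open>G \<subseteq> E\<close> at a time. On the multiplicative side the sets of indices are pairs \<open>(I, G)\<close>, where
  \<open>I\<close> is a set of coordinate hyperplanes, and for fixed \<open>G\<close> one sums over all \<open>I\<close>.

  If the additive equations of \<open>G\<close> have a solution \<open>p\<close>, then scaling the coordinates by
  \<open>a powr p\<^sub>i\<close> straightens the multiplicative equations, and translating by \<open>p\<close> straightens the
  additive ones, to the same system \<open>x\<^sub>i = x\<^sub>j\<close>. Its solutions are the vectors that are constant
  on the blocks of a partition into, say, \<open>c\<close> blocks; so \<open>G\<close> contributes \<open>t\<^sup>c\<close> on the additive
  side, up to sign. On the multiplicative side \<open>I\<close> kills the blocks that it meets. Each block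
  contributes a factor \<open>t\<close> if it is not met, and the sum of the signs of its nonempty subsets,
  which is \<open>-1\<close>, if it is; summing over \<open>I\<close> gives \<open>(t - 1)\<^sup>c\<close>
  (\<open>signed_sum_unmet_blocks\<close>).

  If the additive equations of \<open>G\<close> have no solution, \<open>G\<close> does not occur on the additive side. On
  the multiplicative side no solution has all coordinates positive, since logarithms of it would
  solve the additive equations. As absolute values and sums of solutions are solutions, some
  coordinate \<open>v\<close> then vanishes on all of them (\<open>unsolvable_imp_vanishing_coordinate\<close>). Adding
  \<open>v\<close> to \<open>I\<close> or removing it changes only the sign, and everything cancels.
\<close>

section \<open>Signed sums over subsets\<close>

text \<open>
  Subsets with and without \<open>v\<close> cancel in pairs. This is the only source of cancellation below.
\<close>

lemma signed_sum_Pow_eq_0: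
  fixes f :: "'a set \<Rightarrow> 'b::comm_ring_1"
  assumes fin: "finite A" and v: "v \<in> A"
    and toggle: "\<And>I. I \<subseteq> A - {v} \<Longrightarrow> f (insert v I) = f I"
  shows "(\<Sum>I\<in>Pow A. (-1) ^ card I * f I) = 0"
proof -
  let ?A' = "A - {v}"
  have "Pow A = Pow ?A' \<union> insert v ` Pow ?A'"
    using v by (metis Pow_insert insert_Diff)
  moreover have "Pow ?A' \<inter> insert v ` Pow ?A' = {}" by auto
  moreover have "inj_on (insert v) (Pow ?A')"
    by (rule inj_onI) (use insert_ident in \<open>simp; blast\<close>)
  ultimately have "(\<Sum>I\<in>Pow A. (-1) ^ card I * f I) =
      (\<Sum>I\<in>Pow ?A'. (-1) ^ card I * f I) +
      (\<Sum>I\<in>Pow ?A'. (-1) ^ card (insert v I) * f (insert v I))"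
    using fin by (simp add: sum.union_disjoint sum.reindex)
  also have "(\<Sum>I\<in>Pow ?A'. (-1) ^ card (insert v I) * f (insert v I)) =
      (\<Sum>I\<in>Pow ?A'. - ((-1) ^ card I * f I))"
  proof (rule sum.cong[OF refl])
    fix I assume "I \<in> Pow ?A'"
    then have "finite I" "v \<notin> I" "f (insert v I) = f I"
      using fin toggle by (auto intro: finite_subset)
    then show "(-1) ^ card (insert v I) * f (insert v I) = - ((-1) ^ card I * f I)"
      by simp
  qed
  finally show ?thesis by (simp add: sum_negf)
qed

text \<open>
  A subset of the union of the blocks is a choice of one subset of each block, so the sum is a
  product over the blocks. The factor of a block is \<open>t\<close> from its empty subset and \<open>-1\<close> from its
  nonempty subsets together.
\<close>

lemma signed_sum_unmet_blocks:
  fixes t :: "'b::comm_ring_1"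
  assumes "finite P" and "\<And>C. C \<in> P \<Longrightarrow> finite C" and "\<And>C. C \<in> P \<Longrightarrow> C \<noteq> {}"
    and "disjoint P"
  shows "(\<Sum>I\<in>Pow (\<Union>P). (-1) ^ card I * t ^ card {C \<in> P. C \<inter> I = {}}) = (t - 1) ^ card P"
  using assms
proof (induction P rule: finite_induct)
  case empty
  then show ?case by simp
next
  case (insert C P)
  let ?U = "\<Union>P"
  let ?f = "\<lambda>I. (-1) ^ card I * t ^ card {D \<in> P. D \<inter> I = {}}"
  let ?g = "\<lambda>J. (-1) ^ card J * (if J = {} then t else 1)"
  have finC: "finite C" and neC: "C \<noteq> {}" and finU: "finite ?U"
    using insert by auto
  have CU: "C \<inter> ?U = {}"
    using insert.hyps(2) insert.prems(3) by (auto simp: pairwise_insert disjnt_def)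
  have "(\<Sum>I\<in>Pow (\<Union>(insert C P)). (-1) ^ card I * t ^ card {D \<in> insert C P. D \<inter> I = {}}) =
      (\<Sum>(J, I)\<in>Pow C \<times> Pow ?U. ?g J * ?f I)"
  \<comment> \<open>The block \<open>C\<close> is unmet by \<open>J \<union> I\<close> iff \<open>J\<close> is empty; the others only see \<open>I\<close>.\<close>
  proof (rule sum.reindex_bij_witness[of _ "\<lambda>(J, I). J \<union> I" "\<lambda>K. (K \<inter> C, K \<inter> ?U)"])
    fix K assume K: "K \<in> Pow (\<Union>(insert C P))"
    let ?J = "K \<inter> C" and ?I = "K \<inter> ?U"
    have "K = ?J \<union> ?I" using K by auto
    moreover have "?J \<inter> ?I = {}" using CU by auto
    ultimately have cardK: "card K = card ?J + card ?I"
      using finC finU by (metis card_Un_disjoint finite_Int)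
    have "{D \<in> P. D \<inter> K = {}} = {D \<in> P. D \<inter> ?I = {}}" by auto
    moreover have "{D \<in> insert C P. D \<inter> K = {}} =
        (if ?J = {} then insert C {D \<in> P. D \<inter> K = {}} else {D \<in> P. D \<inter> K = {}})"
      by auto
    ultimately have "t ^ card {D \<in> insert C P. D \<inter> K = {}} =
        (if ?J = {} then t else 1) * t ^ card {D \<in> P. D \<inter> ?I = {}}"
      using insert.hyps by simp
    then show "(case (?J, ?I) of (J, I) \<Rightarrow> ?g J * ?f I) =
        (-1) ^ card K * t ^ card {D \<in> insert C P. D \<inter> K = {}}"
      by (simp add: cardK power_add mult_ac)
  qed (use CU in auto)
  also have "\<dots> = (\<Sum>J\<in>Pow C. ?g J) * (\<Sum>I\<in>Pow ?U. ?f I)"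
    by (simp add: sum_product sum.cartesian_product)
  also have "(\<Sum>I\<in>Pow ?U. ?f I) = (t - 1) ^ card P"
    using insert by (simp add: pairwise_insert)
  also have "(\<Sum>J\<in>Pow C. ?g J) = t - 1"
  proof -
    have "(\<Sum>J\<in>Pow C. ?g J) =
        (\<Sum>J\<in>Pow C. (-1) ^ card J * 1 + (if J = {} then t - 1 else 0))"
      by (rule sum.cong) auto
    also have "\<dots> = (\<Sum>J\<in>Pow C. (-1) ^ card J * 1) + (t - 1)"
      using finC by (simp add: sum.distrib)
    also have "(\<Sum>J\<in>Pow C. (-1) ^ card J * (1::'b)) = 0"
      using signed_sum_Pow_eq_0[of C _ "\<lambda>_. 1"] finC neC by blast
    finally show ?thesis by simp
  qed
  finally show ?case using insert.hyps by simp
qed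

section \<open>Whitney's theorem\<close>

text \<open>
  The family \<open>h\<close> may list a set several times: the indices of the members that contain a
  given flat still form a set, and it is nonempty for every flat other than the whole space, so
  the signs of its subsets cancel. Thus the signed sums on the right satisfy the recursion that
  defines the Moebius function.
\<close>

lemma mobius_eq_signed_sum:
  fixes h :: "'i \<Rightarrow> 'a set"
  assumes fin: "finite E" and proper: "UNIV \<notin> h ` E" and x: "x \<in> flats (h ` E)"
  shows "mobius (intersection_poset (h ` E)) UNIV x =
    (\<Sum>G | G \<subseteq> E \<and> \<Inter>(h ` G) = x. (-1) ^ card G)"
  using x
proof (induction "card {z \<in> flats (h ` E). x \<subseteq> z}" arbitrary: x rule: less_induct)
  case less
  let ?F = "flats (h ` E)"
  let ?r = "intersection_poset (h ` E)"
  let ?\<nu> = "\<lambda>z. \<Sum>G | G \<subseteq> E \<and> \<Inter>(h ` G) = z. (-1) ^ card G :: int"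
  have finF: "finite ?F" using fin by (simp add: finite_flats)
  have U: "UNIV \<in> ?F" by (auto simp: flats_def intro!: exI[of _ "{}"])
  have r: "finite ?r" "Partial_order ?r" "(UNIV, x) \<in> ?r"
    using fin U less.prems
    by (simp_all add: finite_intersection_poset Partial_order_intersection_poset)
      (simp add: intersection_poset_def)
  show ?case
  proof (cases "x = UNIV")
    case True
    have "G = {}" if "G \<subseteq> E" "\<Inter>(h ` G) = UNIV" for G
    proof (rule ccontr)
      assume "G \<noteq> {}"
      then obtain e where "e \<in> G" by blast
      moreover from this have "h e = UNIV" using that(2) by blast
      ultimately show False using proper that(1) by force
    qed
    then have "{G. G \<subseteq> E \<and> \<Inter>(h ` G) = UNIV} = {{}}"
      by auto
    then show ?thesis
      using r True by (simp add: mobius.simps)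
  next
    case False
    have below: "{z. (UNIV, z) \<in> ?r \<and> (z, x) \<in> ?r \<and> z \<noteq> x} = {z \<in> ?F. x \<subseteq> z} - {x}"
      using U less.prems by (auto simp: intersection_poset_def)
    have IH: "mobius ?r UNIV z = ?\<nu> z" if "z \<in> {z \<in> ?F. x \<subseteq> z} - {x}" for z
    proof (rule less.hyps)
      show "card {w \<in> ?F. z \<subseteq> w} < card {w \<in> ?F. x \<subseteq> w}"
        by (rule psubset_card_mono) (use that finF less.prems in auto)
    qed (use that in auto)
    let ?E = "{e \<in> E. x \<subseteq> h e}"
    obtain B where B: "B \<subseteq> E" "x = \<Inter>(h ` B)"
      using less.prems by (auto simp: flats_def subset_image_iff)
    then obtain e where "e \<in> ?E"
      using False by auto
    then have "0 = (\<Sum>G\<in>Pow ?E. (-1) ^ card G :: int)"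
      using signed_sum_Pow_eq_0[of ?E e "\<lambda>_. 1 :: int"] fin by simp
    also have "\<dots> = (\<Sum>z\<in>{z \<in> ?F. x \<subseteq> z}.
        \<Sum>G\<in>{G \<in> Pow ?E. \<Inter>(h ` G) = z}. (-1) ^ card G)"
    proof (rule sum.group[symmetric])
      show "(\<lambda>G. \<Inter>(h ` G)) ` Pow ?E \<subseteq> {z \<in> ?F. x \<subseteq> z}"
      proof (clarsimp, intro conjI)
        fix G assume G: "G \<subseteq> ?E"
        then show "x \<subseteq> (\<Inter>e\<in>G. h e)" by auto
        moreover have "x \<noteq> {}" using less.prems by (auto simp: flats_def)
        ultimately show "(\<Inter>e\<in>G. h e) \<in> ?F"
          using G unfolding flats_def by blast
      qed
    qed (use fin finF in auto)
    also have "\<dots> = (\<Sum>z\<in>{z \<in> ?F. x \<subseteq> z}. ?\<nu> z)"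
      by (intro sum.cong) auto
    also have "\<dots> = ?\<nu> x + (\<Sum>z\<in>{z \<in> ?F. x \<subseteq> z} - {x}. ?\<nu> z)"
      using finF less.prems by (subst sum.remove[of _ x]) auto
    finally have "- (\<Sum>z\<in>{z \<in> ?F. x \<subseteq> z} - {x}. ?\<nu> z) = ?\<nu> x" by linarith
    moreover have "mobius ?r UNIV x = - (\<Sum>z\<in>{z \<in> ?F. x \<subseteq> z} - {x}. mobius ?r UNIV z)"
      using r False below by (subst mobius.simps) auto
    ultimately show ?thesis using IH by simp
  qed
qed

text \<open>
  Grouping the sets of indices by the flat that they cut out leaves the sets with empty
  intersection, which belong to no flat.
\<close>

lemma characteristic_poly_Whitney:
  fixes h :: "'i \<Rightarrow> 'a::euclidean_space set"
  assumes fin: "finite E" and proper: "UNIV \<notin> h ` E"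
  shows "characteristic_poly (h ` E) =
    (\<Sum>G\<in>Pow E. if \<Inter>(h ` G) = {} then 0 else monom ((-1) ^ card G) (nat (aff_dim (\<Inter>(h ` G)))))"
proof -
  let ?F = "flats (h ` E)"
  let ?P = "{G \<in> Pow E. \<Inter>(h ` G) \<noteq> {}}"
  let ?m = "\<lambda>G. monom ((-1) ^ card G) (nat (aff_dim (\<Inter>(h ` G)))) :: int poly"
  have "characteristic_poly (h ` E) =
      (\<Sum>x\<in>?F. \<Sum>G\<in>{G \<in> ?P. \<Inter>(h ` G) = x}. ?m G)"
    unfolding characteristic_poly_def
  proof (rule sum.cong[OF refl])
    fix x assume x: "x \<in> ?F"
    then have "{G. G \<subseteq> E \<and> \<Inter>(h ` G) = x} = {G \<in> ?P. \<Inter>(h ` G) = x}"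
      by (auto simp: flats_def)
    then have "monom (mobius (intersection_poset (h ` E)) UNIV x) (nat (aff_dim x)) =
        (\<Sum>G\<in>{G \<in> ?P. \<Inter>(h ` G) = x}. monom ((-1) ^ card G) (nat (aff_dim x)))"
      using x assms by (simp add: mobius_eq_signed_sum monom_sum)
    also have "\<dots> = (\<Sum>G\<in>{G \<in> ?P. \<Inter>(h ` G) = x}. ?m G)"
      by (rule sum.cong) auto
    finally show "monom (mobius (intersection_poset (h ` E)) UNIV x) (nat (aff_dim x)) =
        (\<Sum>G\<in>{G \<in> ?P. \<Inter>(h ` G) = x}. ?m G)" .
  qed
  also have "\<dots> = (\<Sum>G\<in>?P. ?m G)"
  proof (rule sum.group)
    show "(\<lambda>G. \<Inter>(h ` G)) ` ?P \<subseteq> ?F"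
      unfolding flats_def by blast
  qed (use fin in \<open>auto simp: finite_flats\<close>)
  also have "\<dots> = (\<Sum>G\<in>Pow E. if \<Inter>(h ` G) = {} then 0 else ?m G)"
    using fin by (intro sum.mono_neutral_cong_left) auto
  finally show ?thesis .
qed

section \<open>Vectors constant on blocks\<close>

text \<open>
  The indicator vectors of the blocks that \<open>I\<close> does not meet form an orthogonal basis.
\<close>

lemma dim_constant_on_blocks:
  fixes R :: "('n::finite \<times> 'n) set" and I :: "'n set"
  assumes R: "equiv UNIV R"
  shows "dim {x :: real ^ 'n. (\<forall>i j. (i, j) \<in> R \<longrightarrow> x $ i = x $ j) \<and> (\<forall>i\<in>I. x $ i = 0)} =
    card {C \<in> UNIV // R. C \<inter> I = {}}" (is "dim ?V = card ?Q")
proof (rule dim_unique)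
  let ?ind = "\<lambda>C :: 'n set. \<chi> i. (if i \<in> C then 1 else 0 :: real)"
  have same_block: "i \<in> C \<longleftrightarrow> j \<in> C" if "(i, j) \<in> R" "C \<in> UNIV // R" for i j C
    using R that by (meson equiv_class_eq_iff in_quotient_imp_closed equivE symD)
  show "?ind ` ?Q \<subseteq> ?V"
    using same_block by (auto 4 3)
  have inj: "inj ?ind"
    by (rule injI) (auto simp: vec_eq_iff split: if_splits)
  then show "card (?ind ` ?Q) = card ?Q"
    by (meson card_image inj_on_subset subset_UNIV)
  show "independent (?ind ` ?Q)"
  proof (rule pairwise_orthogonal_independent)
    show "pairwise orthogonal (?ind ` ?Q)"
    proof (rule pairwiseI)
      fix v w assume "v \<in> ?ind ` ?Q" "w \<in> ?ind ` ?Q" "v \<noteq> w"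
      then obtain C D where CD: "C \<in> UNIV // R" "D \<in> UNIV // R" "C \<noteq> D"
        and vw: "v = ?ind C" "w = ?ind D"
        by auto
      have "C \<inter> D = {}" using R CD quotient_disj by metis
      then show "orthogonal v w"
        unfolding vw by (auto simp: orthogonal_def inner_vec_def intro!: sum.neutral)
    qed
    show "0 \<notin> ?ind ` ?Q"
    proof
      assume "0 \<in> ?ind ` ?Q"
      then obtain C where C: "C \<in> UNIV // R" "?ind C = 0" by auto
      then obtain i where "i \<in> C" using R in_quotient_imp_non_empty by blast
      moreover have "?ind C $ i = 0" unfolding C(2) by simp
      ultimately show False by simp
    qed
  qed
  show "?V \<subseteq> span (?ind ` ?Q)"
  proof
    fix x assume x: "x \<in> ?V"
    define rep where "rep C = (SOME i. i \<in> C)" for C :: "'n set"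
    have "x = (\<Sum>C\<in>?Q. x $ rep C *\<^sub>R ?ind C)"
    proof (subst vec_eq_iff, rule allI)
      fix i
      let ?C = "R `` {i}"
      have C: "?C \<in> UNIV // R" and i: "i \<in> ?C"
        using equiv_class_self[OF R] by (auto simp: quotientI)
      have eq: "i \<in> C \<longleftrightarrow> C = ?C" if "C \<in> UNIV // R" for C
        using R C i that by (metis disjoint_iff quotient_disj)
      have xc: "x $ j = x $ i" if "j \<in> ?C" for j
        using x that by auto
      have "(\<Sum>C\<in>?Q. x $ rep C *\<^sub>R ?ind C) $ i = (\<Sum>C\<in>?Q. if C = ?C then x $ rep C else 0)"
        unfolding sum_component by (rule sum.cong) (auto simp: eq)
      also have "\<dots> = (if ?C \<in> ?Q then x $ rep ?C else 0)"
        by simp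
      also have "\<dots> = x $ i"
      proof (cases "?C \<inter> I = {}")
        case True
        have "rep ?C \<in> ?C" unfolding rep_def using i by (rule someI)
        then show ?thesis using True C xc by simp
      next
        case False
        then obtain j where "j \<in> ?C" "j \<in> I" by blast
        then show ?thesis using x xc False by auto
      qed
      finally show "x $ i = (\<Sum>C\<in>?Q. x $ rep C *\<^sub>R ?ind C) $ i" by simp
    qed
    also have "\<dots> \<in> span (?ind ` ?Q)"
      by (intro span_sum span_scale span_base imageI)
    finally show "x \<in> span (?ind ` ?Q)" .
  qed
qed

section \<open>The additive and multiplicative systems of a set of indices\<close>

definition sols_add :: "('n::finite \<times> 'n \<times> int) set \<Rightarrow> (real ^ 'n) set" where
  "sols_add G = {x. \<forall>i j k. (i, j, k) \<in> G \<longrightarrow> x $ i - x $ j = of_int k}"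

definition sols_mult :: "real \<Rightarrow> ('n::finite \<times> 'n \<times> int) set \<Rightarrow> 'n set \<Rightarrow> (real ^ 'n) set" where
  "sols_mult a G I = {x. (\<forall>i j k. (i, j, k) \<in> G \<longrightarrow> x $ i = a powi k * x $ j) \<and> (\<forall>i\<in>I. x $ i = 0)}"

text \<open>
  Both systems are reduced to the homogeneous system \<open>x\<^sub>i = x\<^sub>j\<close>.
\<close>

definition sols_eq :: "('n::finite \<times> 'n \<times> int) set \<Rightarrow> 'n set \<Rightarrow> (real ^ 'n) set" where
  "sols_eq G I = {x. (\<forall>i j k. (i, j, k) \<in> G \<longrightarrow> x $ i = x $ j) \<and> (\<forall>i\<in>I. x $ i = 0)}"

text \<open>
  The blocks are the connected components of the graph with an edge \<open>{i, j}\<close> for each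
  \<open>(i, j, k) \<in> G\<close>. Describing connectedness by the equations that follow from the system makes it
  an equivalence relation without any argument about paths.
\<close>

definition block_rel :: "('n::finite \<times> 'n \<times> int) set \<Rightarrow> ('n \<times> 'n) set" where
  "block_rel G = {(i, j). \<forall>x\<in>sols_eq G {} :: (real ^ 'n) set. x $ i = x $ j}"

lemma equiv_block_rel: "equiv UNIV (block_rel G)"
  by (auto simp: block_rel_def equiv_def refl_on_def sym_def trans_def)

lemma dim_sols_eq:
  fixes G :: "('n::finite \<times> 'n \<times> int) set"
  shows "dim (sols_eq G I) = card {C \<in> UNIV // block_rel G. C \<inter> I = {}}"
proof -
  have "x \<in> sols_eq G {} \<longleftrightarrow> (\<forall>i j. (i, j) \<in> block_rel G \<longrightarrow> x $ i = x $ j)" for x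
  proof
    assume "\<forall>i j. (i, j) \<in> block_rel G \<longrightarrow> x $ i = x $ j"
    moreover have "(i, j) \<in> block_rel G" if "(i, j, k) \<in> G" for i j k
      using that by (auto simp: block_rel_def sols_eq_def)
    ultimately show "x \<in> sols_eq G {}"
      by (auto simp: sols_eq_def)
  qed (auto simp: block_rel_def)
  moreover have "sols_eq G I = {x \<in> sols_eq G {}. \<forall>i\<in>I. x $ i = 0}"
    by (auto simp: sols_eq_def)
  ultimately have "sols_eq G I =
      {x. (\<forall>i j. (i, j) \<in> block_rel G \<longrightarrow> x $ i = x $ j) \<and> (\<forall>i\<in>I. x $ i = 0)}"
    by simp
  then show ?thesis
    using dim_constant_on_blocks[OF equiv_block_rel, of G I] by simp
qed

lemma subspace_sols_eq: "subspace (sols_eq G I)"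
  unfolding subspace_def sols_eq_def by (simp; metis)

lemma subspace_sols_mult: "subspace (sols_mult a G I)"
  unfolding subspace_def sols_mult_def by (simp add: algebra_simps; metis)

text \<open>Translation by one solution maps the homogeneous system to the additive one.\<close>

lemma aff_dim_sols_add:
  fixes G :: "('n::finite \<times> 'n \<times> int) set"
  assumes p: "p \<in> sols_add G"
  shows "aff_dim (sols_add G) = dim (sols_eq G {})"
proof -
  have "sols_add G = (+) p ` sols_eq G {}"
  proof (intro equalityI subsetI)
    fix x assume "x \<in> sols_add G"
    then have "x - p \<in> sols_eq G {}"
      using p by (force simp: sols_add_def sols_eq_def)
    then show "x \<in> (+) p ` sols_eq G {}"
      by (metis add_diff_cancel_left' add_diff_eq imageI)
  qed (use p in \<open>force simp: sols_add_def sols_eq_def\<close>)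
  then show ?thesis
    by (simp add: aff_dim_translation_eq aff_dim_subspace subspace_sols_eq)
qed

text \<open>
  The diagonal matrix with entries \<open>a powr p\<^sub>i\<close> maps the homogeneous system to the multiplicative
  one, and it preserves the coordinate hyperplanes.
\<close>

lemma dim_sols_mult:
  fixes G :: "('n::finite \<times> 'n \<times> int) set"
  assumes a: "a > 0" and p: "p \<in> sols_add G"
  shows "dim (sols_mult a G I) = dim (sols_eq G I)"
proof -
  let ?D = "\<lambda>x :: real ^ 'n. \<chi> i. a powr (p $ i) * x $ i"
  have pos: "a powr s > 0" for s using a by simp
  have lin: "linear ?D"
    by (rule linearI) (simp_all add: vec_eq_iff algebra_simps)
  have inj: "inj ?D"
    by (rule injI) (use a in \<open>simp add: vec_eq_iff\<close>)
  have scale: "a powi k * a powr (p $ j) = a powr (p $ i)" if "(i, j, k) \<in> G" for i j k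
  proof -
    have "p $ i = of_int k + p $ j" using p that by (force simp: sols_add_def)
    then show ?thesis using a by (simp add: powr_add powr_real_of_int')
  qed
  have D_iff: "?D x \<in> sols_mult a G I \<longleftrightarrow> x \<in> sols_eq G I" for x
  proof -
    have "a powr (p $ i) * x $ i = a powi k * (a powr (p $ j) * x $ j) \<longleftrightarrow> x $ i = x $ j"
      if "(i, j, k) \<in> G" for i j k
      using scale[OF that] pos[of "p $ i"] by (metis mult.assoc mult_cancel_left less_irrefl)
    then show ?thesis using a by (auto simp: sols_mult_def sols_eq_def)
  qed
  have surj: "\<exists>x. y = ?D x" for y
    by (rule exI[of _ "\<chi> i. y $ i / a powr (p $ i)"]) (use a in \<open>simp add: vec_eq_iff\<close>)
  have "sols_mult a G I = ?D ` sols_eq G I"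
  proof (intro equalityI subsetI)
    fix y assume y: "y \<in> sols_mult a G I"
    obtain x where "y = ?D x" using surj by blast
    then show "y \<in> ?D ` sols_eq G I" using y D_iff by blast
  qed (use D_iff in blast)
  then show ?thesis
    using dim_image_eq[OF lin inj_on_subset[OF inj]] by simp
qed

text \<open>
  Contrapositively, suppose that every coordinate \<open>v\<close> is nonzero on some solution \<open>w v\<close>. Powers of
  \<open>a\<close> are positive, so the sum of the absolute values of the \<open>w v\<close> is again a solution, now with all
  coordinates positive, and its logarithms to base \<open>a\<close> solve the additive system.
\<close>

lemma unsolvable_imp_vanishing_coordinate:
  fixes G :: "('n::finite \<times> 'n \<times> int) set"
  assumes a: "a > 1" and unsolvable: "sols_add G = {}"
  obtains v where "\<And>x. x \<in> sols_mult a G {} \<Longrightarrow> x $ v = 0"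
proof (rule ccontr)
  assume "\<not> thesis"
  then have "\<forall>v. \<exists>x\<in>sols_mult a G {}. x $ v \<noteq> 0" using that by blast
  then obtain w where w: "\<And>v. w v \<in> sols_mult a G {}" "\<And>v. w v $ v \<noteq> 0" by metis
  define y :: "real ^ 'n" where "y = (\<chi> i. \<Sum>v\<in>UNIV. \<bar>w v $ i\<bar>)"
  have pos: "y $ i > 0" for i
    unfolding y_def by (auto intro!: sum_pos2[of _ i] simp: w(2))
  have y: "y $ i = a powi k * y $ j" if e: "(i, j, k) \<in> G" for i j k
  proof -
    have "\<bar>w v $ i\<bar> = a powi k * \<bar>w v $ j\<bar>" for v
    proof -
      have "w v $ i = a powi k * w v $ j"
        using w(1)[of v] e by (auto simp: sols_mult_def)
      then show ?thesis using a by (simp add: abs_mult)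
    qed
    then show ?thesis by (simp add: y_def sum_distrib_left)
  qed
  have "(\<chi> i. log a (y $ i)) \<in> sols_add G"
  proof -
    have "log a (y $ i) - log a (y $ j) = of_int k" if e: "(i, j, k) \<in> G" for i j k
    proof -
      have "y $ i = a powr of_int k * y $ j"
        using y[OF e] a by (simp add: powr_real_of_int')
      then show ?thesis using a pos[of j] by (simp add: log_mult)
    qed
    then show ?thesis by (auto simp: sols_add_def)
  qed
  with unsolvable show False by simp
qed

text \<open>
  The right-hand side is, up to sign, the term of \<open>G\<close> in the characteristic polynomial of the
  additive arrangement, with \<open>t - 1\<close> in place of \<open>t\<close>.
\<close>

lemma signed_sum_sols_mult:
  fixes G :: "('n::finite \<times> 'n \<times> int) set" and t :: "'b::comm_ring_1"
  assumes a: "a > 1"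
  shows "(\<Sum>I\<in>UNIV. (-1) ^ card I * t ^ dim (sols_mult a G I)) =
    (if sols_add G = {} then 0 else (t - 1) ^ dim (sols_eq G {}))"
proof (cases "sols_add G = {}")
  case True
  then obtain v where v: "\<And>x. x \<in> sols_mult a G {} \<Longrightarrow> x $ v = 0"
    using a unsolvable_imp_vanishing_coordinate by blast
  have "sols_mult a G (insert v I) = sols_mult a G I" for I
    using v by (auto simp: sols_mult_def)
  then have "(\<Sum>I\<in>Pow UNIV. (-1) ^ card I * t ^ dim (sols_mult a G I)) = 0"
    by (intro signed_sum_Pow_eq_0[of _ v]) auto
  then show ?thesis using True by simp
next
  case False
  then obtain p where p: "p \<in> sols_add G" by blast
  let ?P = "UNIV // block_rel G"
  have "(\<Sum>I\<in>UNIV. (-1) ^ card I * t ^ dim (sols_mult a G I)) =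
      (\<Sum>I\<in>Pow (\<Union>?P). (-1) ^ card I * t ^ card {C \<in> ?P. C \<inter> I = {}})"
    using a p by (simp add: dim_sols_mult dim_sols_eq Union_quotient[OF equiv_block_rel])
  also have "\<dots> = (t - 1) ^ card ?P"
  proof (rule signed_sum_unmet_blocks)
    show "C \<noteq> {}" if "C \<in> ?P" for C
      using that in_quotient_imp_non_empty[OF equiv_block_rel] by blast
    show "disjoint ?P"
      using quotient_disj[OF equiv_block_rel] by (auto simp: pairwise_def disjnt_def)
  qed auto
  also have "card ?P = dim (sols_eq G {})" by (simp add: dim_sols_eq)
  finally show ?thesis using False by simp
qed

section \<open>The two characteristic polynomials\<close>

definition indices :: "int set \<Rightarrow> ('n::linorder \<times> 'n \<times> int) set" where
  "indices S = {(i, j, k). k \<in> S \<and> i < j}"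

lemma finite_indices:
  assumes "finite S"
  shows "finite (indices S :: ('n::{finite,linorder} \<times> 'n \<times> int) set)"
  by (rule finite_subset[of _ "UNIV \<times> UNIV \<times> S"]) (use assms in \<open>auto simp: indices_def\<close>)

lemma characteristic_poly_arrangement_C:
  assumes "finite S"
  shows "characteristic_poly (arrangement_C S :: (real ^ 'n::{finite,linorder}) set set) =
    (\<Sum>G\<in>Pow (indices S :: ('n \<times> 'n \<times> int) set).
      if sols_add G = {} then 0 else monom ((-1) ^ card G) (dim (sols_eq G {})))"
proof -
  let ?E = "indices S :: ('n \<times> 'n \<times> int) set"
  let ?h = "\<lambda>(i, j, k). {x :: (real, 'n) vec. x $ i - x $ j = of_int k}"
  have arr: "arrangement_C S = ?h ` ?E"
    by (force simp: arrangement_C_def indices_def)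
  have Int: "\<Inter>(?h ` G) = sols_add G" for G
    by (force simp: sols_add_def)
  have proper: "UNIV \<notin> ?h ` ?E"
  proof
    assume "UNIV \<in> ?h ` ?E"
    then obtain i j k where ij: "i < j" and univ: "UNIV = ?h (i, j, k)"
      by (auto simp: indices_def)
    have all: "x $ i - x $ j = of_int k" for x :: "(real, 'n) vec"
    proof -
      have "x \<in> ?h (i, j, k)" unfolding univ[symmetric] by simp
      then show ?thesis by simp
    qed
    \<comment> \<open>The left-hand side is \<open>0\<close> at the origin and \<open>1\<close> at the unit vector.\<close>
    show False using all[of 0] all[of "axis i 1"] ij by (auto simp: axis_def split: if_splits)
  qed
  show ?thesis
    unfolding arr characteristic_poly_Whitney[OF finite_indices[OF assms] proper] Int
    by (intro sum.cong refl) (auto simp: aff_dim_sols_add)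
qed

lemma characteristic_poly_arrangement_A:
  assumes "finite S"
  shows "characteristic_poly (arrangement_A a S :: (real ^ 'n::{finite,linorder}) set set) =
    (\<Sum>G\<in>Pow (indices S :: ('n \<times> 'n \<times> int) set). \<Sum>I\<in>UNIV.
      monom ((-1) ^ (card I + card G)) (dim (sols_mult a G I)))"
proof -
  let ?E = "indices S :: ('n \<times> 'n \<times> int) set"
  let ?c = "\<lambda>i. {x :: (real, 'n) vec. x $ i = 0}"
  let ?m = "\<lambda>(i, j, k). {x :: (real, 'n) vec. x $ i = a powi k * x $ j}"
  let ?h = "case_sum ?c ?m"
  have image: "?h ` (I <+> G) = ?c ` I \<union> ?m ` G" for I G
    unfolding Plus_def image_Un image_image by simp
  have "?m ` ?E = {{x. x $ i = a powi k * x $ j} |i j k. k \<in> S \<and> i < j}"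
    by (force simp: indices_def)
  then have arr: "arrangement_A a S = ?h ` (UNIV <+> ?E)"
    unfolding image arrangement_A_def by (simp add: full_SetCompr_eq)
  have Int: "\<Inter>(?h ` (I <+> G)) = sols_mult a G I" for I G
  proof -
    have "\<Inter>(?h ` (I <+> G)) = {x. \<forall>i\<in>I. x $ i = 0} \<inter> \<Inter>(?m ` G)"
      unfolding image by auto
    moreover have "\<Inter>(?m ` G) = {x. \<forall>i j k. (i, j, k) \<in> G \<longrightarrow> x $ i = a powi k * x $ j}"
      by force
    ultimately show ?thesis
      unfolding sols_mult_def by blast
  qed
  have "?c i \<noteq> UNIV" for i
  proof
    assume univ: "?c i = UNIV"
    have "axis i 1 \<in> ?c i" unfolding univ by simp
    then show False by simp
  qed
  moreover have "?m (i, j, k) \<noteq> UNIV" if "i < j" for i j k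
  proof
    assume univ: "?m (i, j, k) = UNIV"
    have "axis i 1 \<in> ?m (i, j, k)" unfolding univ by simp
    then show False using that by (auto simp: axis_def split: if_splits)
  qed
  ultimately have proper: "UNIV \<notin> ?h ` (UNIV <+> ?E)"
    unfolding image indices_def by (fastforce dest: sym)
  have fin: "finite ?E" using assms by (rule finite_indices)
  let ?f = "\<lambda>H. if \<Inter>(?h ` H) = {} then 0
    else monom ((-1) ^ card H) (nat (aff_dim (\<Inter>(?h ` H)))) :: int poly"
  have "characteristic_poly (arrangement_A a S :: (real, 'n) vec set set) =
      (\<Sum>H\<in>Pow (UNIV <+> ?E). ?f H)"
    unfolding arr by (rule characteristic_poly_Whitney) (use fin proper in auto)
  also have "\<dots> = (\<Sum>(G, I)\<in>Pow ?E \<times> UNIV. ?f (I <+> G))"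
  proof (rule sum.reindex_bij_witness[of _ "\<lambda>(G, I). I <+> G" "\<lambda>H. (Inr -` H, Inl -` H)"])
    have parts: "(Inl -` H) <+> (Inr -` H) = H" for H :: "('n + 'n \<times> 'n \<times> int) set"
    proof (rule set_eqI)
      show "z \<in> (Inl -` H) <+> (Inr -` H) \<longleftrightarrow> z \<in> H" for z by (cases z) auto
    qed
    fix H :: "('n + 'n \<times> 'n \<times> int) set"
    show "(case (Inr -` H, Inl -` H) of (G, I) \<Rightarrow> I <+> G) = H"
      "(case (Inr -` H, Inl -` H) of (G, I) \<Rightarrow> ?f (I <+> G)) = ?f H"
      by (simp_all only: prod.case parts)
  qed auto
  also have "\<dots> = (\<Sum>G\<in>Pow ?E. \<Sum>I\<in>UNIV. ?f (I <+> G))"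
    by (simp add: sum.cartesian_product)
  also have "\<dots> = (\<Sum>G\<in>Pow ?E. \<Sum>I\<in>UNIV.
      monom ((-1) ^ (card I + card G)) (dim (sols_mult a G I)))"
  proof (intro sum.cong refl)
    fix G I assume G: "G \<in> Pow ?E"
    have "sols_mult a G I \<noteq> {}"
      using subspace_0[OF subspace_sols_mult] by blast
    moreover have "card (I <+> G) = card I + card G"
      using finite_subset[of G ?E] G fin by (simp add: card_Plus)
    ultimately show "?f (I <+> G) = monom ((-1) ^ (card I + card G)) (dim (sols_mult a G I))"
      unfolding Int by (simp add: aff_dim_subspace subspace_sols_mult)
  qed
  finally show ?thesis .
qed

theorem theorem2p10:
  fixes a :: real and S :: "int set"
  assumes "a > 1" and "finite S"
  shows "characteristic_poly (arrangement_A a S :: (real ^ 'n::{finite,linorder}) set set) =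
         characteristic_poly (arrangement_C S :: (real ^ 'n::{finite,linorder}) set set) \<circ>\<^sub>p [:-1, 1:]"
proof -
  let ?t = "[:0, 1:] :: int poly"
  have monom_signed: "monom ((-1) ^ m) d = (-1) ^ m * ?t ^ d" for m d
  proof -
    have "monom ((-1) ^ m) d = [:(-1) ^ m:] * ?t ^ d" by (simp add: monom_altdef)
    also have "[:(-1) ^ m:] = [:-1 :: int:] ^ m" by (simp add: poly_const_pow)
    also have "[:-1 :: int:] = -1" by (simp add: one_pCons)
    finally show ?thesis .
  qed
  have pcompose_pow: "(p ^ d) \<circ>\<^sub>p q = (p \<circ>\<^sub>p q) ^ d" for p q :: "int poly" and d
    by (induction d) (simp_all add: pcompose_1 pcompose_mult)
  have shift: "monom ((-1) ^ m) d \<circ>\<^sub>p [:-1, 1:] = (-1) ^ m * (?t - 1) ^ d" for m d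
    unfolding monom_signed
    by (simp add: pcompose_mult pcompose_pow pcompose_uminus pcompose_1 pcompose_pCons one_pCons)
  show ?thesis
    unfolding characteristic_poly_arrangement_A[OF assms(2)]
      characteristic_poly_arrangement_C[OF assms(2)] pcompose_sum
  proof (intro sum.cong refl)
    fix G :: "('n \<times> 'n \<times> int) set"
    have "(\<Sum>I\<in>UNIV. monom ((-1) ^ (card I + card G)) (dim (sols_mult a G I))) =
        (-1) ^ card G * (\<Sum>I\<in>UNIV. (-1) ^ card I * ?t ^ dim (sols_mult a G I))"
      unfolding monom_signed unfolding sum_distrib_left power_add
      by (intro sum.cong refl) (simp add: mult_ac)
    also have "\<dots> = (if sols_add G = {} then 0 else monom ((-1) ^ card G) (dim (sols_eq G {})))
        \<circ>\<^sub>p [:-1, 1:]"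
      using assms(1) by (simp add: signed_sum_sols_mult shift)
    finally show "(\<Sum>I\<in>UNIV. monom ((-1) ^ (card I + card G)) (dim (sols_mult a G I))) =
        (if sols_add G = {} then 0 else monom ((-1) ^ card G) (dim (sols_eq G {})) :: int poly)
        \<circ>\<^sub>p [:-1, 1:]" .
  qed
qed

end
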